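(* Let $0<\mu<L$ and $(\gamma,\beta)\in\Omega_{\mathrm{cv}}(\mathcal Q_{\mu,L})$. If $\mathrm{HB}_{\gamma,\beta}$ has a cycle on $\mathcal F_{\mu,L}$, then $\mathrm{HB}_{\gamma,\beta}$ cycles on a symmetric cycle on $\mathcal F_{\mu,L}$; that is, there exist an integer $K\ge2$, points $(x_t)_{0\le t\le K-1}$ not all equal, $f\in\mathcal F_{\mu,L}$, and reals $(c_s)_{0\le s\le K-1}$ such that $\mathrm{HB}_{\gamma,\beta}(f)$ cycles on $(x_0,\dots,x_{K-1})$ and the Gram matrix of $(x_0,\dots,x_{K-1})$ is symmetric circulant, i.e. (indices modulo $K$): 1. for all $t$, $\|x_t\|^2=c_0$; 2. for all $t$, $\langle x_t,x_{t+1}\rangle=c_1$; 3. more generally, for all $s,t\in\{0,\dots,K-1\}$, $\langle x_t,x_{t+s}\rangle=c_s$.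
   Context: For $0<\mu\le L$, $\mathcal F_{\mu,L}$ is the set of continuously differentiable functions $f:\mathbb R^d\to\mathbb R$ ($d\ge1$ arbitrary) with $f(x)\le f(y)+\langle\nabla f(y),x-y\rangle+\frac L2\|x-y\|^2$ and $f(x)\ge f(y)+\langle\nabla f(y),x-y\rangle+\frac\mu2\|x-y\|^2$ for all $x,y$. For $\gamma,\beta\in\mathbb R$ and differentiable $f$, $\mathrm{HB}_{\gamma,\beta}(f)$ is the iteration $z_{t+1}=z_t-\gamma\nabla f(z_t)+\beta(z_t-z_{t-1})$, $t\ge1$, from initial points $z_0,z_1$. For an integer $K$ and $K$ points $(x_0,\dots,x_{K-1})$ not all equal, $\mathrm{HB}_{\gamma,\beta}(f)$ cycles on $(x_0,\dots,x_{K-1})$ if the sequence initialized at $z_0=x_0,z_1=x_1$ satisfies $z_t=x_{t\bmod K}$ for all $t\ge0$. $\mathrm{HB}_{\gamma,\beta}$ has a cycle on a class $\mathcal F$ if there exist $K$, points $(x_0,\dots,x_{K-1})$ not all equal, and $f\in\mathcal F$ such that $\mathrm{HB}_{\gamma,\beta}(f)$ cycles on $(x_0,\dots,x_{K-1})$. $\Omega_{\mathrm{cv}}(\mathcal Q_{\mu,L})=\{(\gamma,\beta):\beta\in(-1,1),\ 0<\gamma<\frac2L(1+\beta)\}$; throughout, $(\gamma,\beta)$ belongs to this set. A $K\times K$ matrix is circulant if its $(i,j)$ entry depends only on $j-i$ modulo $K$. *)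

theory Defs
  imports "HOL-Analysis.Analysis"
begin

text \<open>
  The dimension \<open>d\<close> is existentially quantified, so \<open>\<real>\<^sup>d\<close> cannot be a type.  It is rendered as the
  library space \<^term>\<open>Euclidean_space d\<close>, whose points are the sequences \<open>nat \<Rightarrow> real\<close> vanishing at all
  indices \<open>i \<ge> d\<close>.  A function on \<open>\<real>\<^sup>d\<close> is a function on \<open>nat \<Rightarrow> real\<close> of which only the values on
  \<^term>\<open>topspace (Euclidean_space d)\<close> matter; the Euclidean norm on \<open>\<real>\<^sup>d\<close> is \<open>L2_set x {..<d}\<close>.
\<close>

abbreviation Rd :: "nat \<Rightarrow> (nat \<Rightarrow> real) set" where
  "Rd d \<equiv> topspace (Euclidean_space d)"

abbreviation vdiff :: "(nat \<Rightarrow> real) \<Rightarrow> (nat \<Rightarrow> real) \<Rightarrow> nat \<Rightarrow> real" where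
  "vdiff x y \<equiv> (\<lambda>i. x i - y i)"

definition dot :: "nat \<Rightarrow> (nat \<Rightarrow> real) \<Rightarrow> (nat \<Rightarrow> real) \<Rightarrow> real" where
  "dot d x y = (\<Sum>i<d. x i * y i)"

abbreviation vnorm :: "nat \<Rightarrow> (nat \<Rightarrow> real) \<Rightarrow> real" where
  "vnorm d x \<equiv> L2_set x {..<d}"

text \<open>Frechet differentiability at \<open>x\<close>; \<open>atin\<close> is the punctured neighbourhood filter of \<open>x\<close>
  in \<open>\<real>\<^sup>d\<close>.\<close>

definition has_gradient ::
  "nat \<Rightarrow> ((nat \<Rightarrow> real) \<Rightarrow> real) \<Rightarrow> (nat \<Rightarrow> real) \<Rightarrow> (nat \<Rightarrow> real) \<Rightarrow> bool" where
  "has_gradient d f g x \<longleftrightarrow> g \<in> Rd d \<and>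
     ((\<lambda>y. (f y - f x - dot d g (vdiff y x)) / vnorm d (vdiff y x)) \<longlongrightarrow> 0)
       (atin (Euclidean_space d) x)"

definition gradient ::
  "nat \<Rightarrow> ((nat \<Rightarrow> real) \<Rightarrow> real) \<Rightarrow> (nat \<Rightarrow> real) \<Rightarrow> (nat \<Rightarrow> real)" where
  "gradient d f x = (THE g. has_gradient d f g x)"

definition continuously_differentiable :: "nat \<Rightarrow> ((nat \<Rightarrow> real) \<Rightarrow> real) \<Rightarrow> bool" where
  "continuously_differentiable d f \<longleftrightarrow>
     (\<forall>x\<in>Rd d. \<exists>g. has_gradient d f g x) \<and>
     continuous_map (Euclidean_space d) (Euclidean_space d) (gradient d f)"

definition smooth_strongly_convex ::
  "real \<Rightarrow> real \<Rightarrow> nat \<Rightarrow> ((nat \<Rightarrow> real) \<Rightarrow> real) set" where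
  "smooth_strongly_convex \<mu> L d = {f. continuously_differentiable d f \<and>
     (\<forall>x\<in>Rd d. \<forall>y\<in>Rd d.
        f x \<le> f y + dot d (gradient d f y) (vdiff x y) + L / 2 * (vnorm d (vdiff x y))\<^sup>2 \<and>
        f x \<ge> f y + dot d (gradient d f y) (vdiff x y) + \<mu> / 2 * (vnorm d (vdiff x y))\<^sup>2)}"

fun heavy_ball ::
  "real \<Rightarrow> real \<Rightarrow> nat \<Rightarrow> ((nat \<Rightarrow> real) \<Rightarrow> real) \<Rightarrow> (nat \<Rightarrow> real) \<Rightarrow> (nat \<Rightarrow> real) \<Rightarrow> nat \<Rightarrow> (nat \<Rightarrow> real)"
where
  "heavy_ball \<gamma> \<beta> d f z0 z1 0 = z0"
| "heavy_ball \<gamma> \<beta> d f z0 z1 (Suc 0) = z1"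
| "heavy_ball \<gamma> \<beta> d f z0 z1 (Suc (Suc t)) =
     (\<lambda>i. heavy_ball \<gamma> \<beta> d f z0 z1 (Suc t) i
          - \<gamma> * gradient d f (heavy_ball \<gamma> \<beta> d f z0 z1 (Suc t)) i
          + \<beta> * (heavy_ball \<gamma> \<beta> d f z0 z1 (Suc t) i - heavy_ball \<gamma> \<beta> d f z0 z1 t i))"

text \<open>Only \<open>x 0, \<dots>, x (K - 1)\<close> matter.  Two distinct points exist, hence \<open>K \<ge> 2\<close>.\<close>

definition HB_cycles_on ::
  "real \<Rightarrow> real \<Rightarrow> nat \<Rightarrow> ((nat \<Rightarrow> real) \<Rightarrow> real) \<Rightarrow> nat \<Rightarrow> (nat \<Rightarrow> nat \<Rightarrow> real) \<Rightarrow> bool" where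
  "HB_cycles_on \<gamma> \<beta> d f K x \<longleftrightarrow>
     (\<forall>t<K. x t \<in> Rd d) \<and> (\<exists>s<K. \<exists>t<K. x s \<noteq> x t) \<and>
     (\<forall>t. heavy_ball \<gamma> \<beta> d f (x 0) (x 1) t = x (t mod K))"

text \<open>The class of functions comprises all dimensions \<open>d \<ge> 1\<close>.\<close>

definition HB_has_cycle :: "real \<Rightarrow> real \<Rightarrow> real \<Rightarrow> real \<Rightarrow> bool" where
  "HB_has_cycle \<gamma> \<beta> \<mu> L \<longleftrightarrow>
     (\<exists>d\<ge>1. \<exists>K x. \<exists>f\<in>smooth_strongly_convex \<mu> L d. HB_cycles_on \<gamma> \<beta> d f K x)"

text \<open>The convergence region on quadratics with spectrum in \<open>[\<mu>, L]\<close>; it does not depend on \<open>\<mu>\<close>.\<close>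

definition Omega_cv :: "real \<Rightarrow> (real \<times> real) set" where
  "Omega_cv L = {(\<gamma>, \<beta>). -1 < \<beta> \<and> \<beta> < 1 \<and> 0 < \<gamma> \<and> \<gamma> < 2 / L * (1 + \<beta>)}"

text \<open>A \<open>K \<times> K\<close> matrix is a function of two indices below \<open>K\<close>.\<close>

definition gram :: "nat \<Rightarrow> (nat \<Rightarrow> nat \<Rightarrow> real) \<Rightarrow> nat \<Rightarrow> nat \<Rightarrow> real" where
  "gram d x i j = dot d (x i) (x j)"

definition symmetric_matrix :: "nat \<Rightarrow> (nat \<Rightarrow> nat \<Rightarrow> real) \<Rightarrow> bool" where
  "symmetric_matrix K A \<longleftrightarrow> (\<forall>i<K. \<forall>j<K. A i j = A j i)"

definition circulant :: "nat \<Rightarrow> (nat \<Rightarrow> nat \<Rightarrow> real) \<Rightarrow> bool" where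
  "circulant K A \<longleftrightarrow>
     (\<forall>i<K. \<forall>j<K. \<forall>i'<K. \<forall>j'<K.
        (int j - int i) mod int K = (int j' - int i') mod int K \<longrightarrow> A i j = A i' j')"

end

theory Submission
  imports Defs
begin

text \<open>
  Stack the \<open>K\<close> cyclic shifts of a cycle of \<open>f\<close> on \<open>\<real>\<^sup>d\<close> into the points
  \<open>X\<^sub>t = (x\<^sub>t, x\<^sub>t\<^sub>+\<^sub>1, \<dots>, x\<^sub>t\<^sub>+\<^sub>K\<^sub>-\<^sub>1)\<close> of \<open>\<real>\<^sup>K\<^sup>d\<close>. The separable function
  \<open>F (y\<^sub>0, \<dots>, y\<^sub>K\<^sub>-\<^sub>1) = f y\<^sub>0 + \<dots> + f y\<^sub>K\<^sub>-\<^sub>1\<close> has the same smoothness and strong convexity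
  constants as \<open>f\<close>, and heavy ball on \<open>F\<close> runs independently on each block, so it cycles on the
  \<open>X\<^sub>t\<close>. The inner product of \<open>X\<^sub>s\<close> and \<open>X\<^sub>t\<close> is the sum of \<open>\<langle>x\<^sub>s\<^sub>+\<^sub>k, x\<^sub>t\<^sub>+\<^sub>k\<rangle>\<close> over
  a full period of \<open>k\<close>, hence depends only on \<open>t - s\<close> modulo \<open>K\<close>.
\<close>

section \<open>Gradients\<close>

lemma vnorm_power2: "(vnorm d x)\<^sup>2 = dot d x x"
  unfolding L2_set_def dot_def by (simp add: sum_nonneg power2_eq_square)

lemma dot_commute: "dot d x y = dot d y x"
  by (simp add: dot_def mult.commute)

lemma Rd_iff: "x \<in> Rd d \<longleftrightarrow> (\<forall>i\<ge>d. x i = 0)"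
  by (simp add: topspace_Euclidean_space)

lemma vnorm_vdiff_pos:
  assumes "x \<in> Rd d" "y \<in> Rd d" "x \<noteq> y"
  shows "vnorm d (vdiff x y) > 0"
proof -
  obtain i where i: "x i \<noteq> y i" using assms(3) by auto
  then have "i < d" using assms(1,2) by (metis Rd_iff not_le)
  then have "vnorm d (vdiff x y) \<noteq> 0" using i by (auto simp: L2_set_eq_0_iff)
  then show ?thesis by (simp add: less_le)
qed

text \<open>The division-free form also covers \<open>y = x\<close>, which makes it stable under block projections.\<close>

lemma has_gradient_iff:
  assumes x: "x \<in> Rd d"
  shows "has_gradient d f g x \<longleftrightarrow> g \<in> Rd d \<and>
    (\<forall>e>0. \<exists>U. openin (Euclidean_space d) U \<and> x \<in> U \<and>
      (\<forall>y\<in>U. \<bar>f y - f x - dot d g (vdiff y x)\<bar> \<le> e * vnorm d (vdiff y x)))"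
    (is "_ \<longleftrightarrow> _ \<and> ?R")
proof -
  define q where "q = (\<lambda>y. f y - f x - dot d g (vdiff y x))"
  define n where "n = (\<lambda>y. vnorm d (vdiff y x))"
  have n0: "n x = 0" and q0: "q x = 0" by (simp_all add: q_def n_def dot_def L2_set_def)
  have n_pos: "n y > 0" if "openin (Euclidean_space d) U" "y \<in> U" "y \<noteq> x" for U y
    using vnorm_vdiff_pos[of y d x] that x openin_subset unfolding n_def by blast
  have "((\<lambda>y. q y / n y) \<longlongrightarrow> 0) (atin (Euclidean_space d) x) \<longleftrightarrow>
      (\<forall>e>0. \<exists>U. openin (Euclidean_space d) U \<and> x \<in> U \<and> (\<forall>y\<in>U - {x}. \<bar>q y / n y\<bar> < e))"
    using x by (simp add: tendsto_iff eventually_atin dist_real_def)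
  also have "\<dots> \<longleftrightarrow> (\<forall>e>0. \<exists>U. openin (Euclidean_space d) U \<and> x \<in> U \<and> (\<forall>y\<in>U. \<bar>q y\<bar> \<le> e * n y))"
    (is "?A \<longleftrightarrow> ?B")
  proof
    assume A: ?A
    show ?B
    proof (intro allI impI)
      fix e :: real assume "e > 0"
      then obtain U where U: "openin (Euclidean_space d) U" "x \<in> U"
        "\<forall>y\<in>U - {x}. \<bar>q y / n y\<bar> < e" using A by meson
      have "\<bar>q y\<bar> \<le> e * n y" if y: "y \<in> U" for y
      proof (cases "y = x")
        case False
        then have "n y > 0" "\<bar>q y / n y\<bar> < e" using U y n_pos by auto
        then show ?thesis by (simp add: abs_divide divide_less_eq)
      qed (simp add: n0 q0)
      then show "\<exists>U. openin (Euclidean_space d) U \<and> x \<in> U \<and> (\<forall>y\<in>U. \<bar>q y\<bar> \<le> e * n y)"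
        using U by blast
    qed
  next
    assume B: ?B
    show ?A
    proof (intro allI impI)
      fix e :: real assume "e > 0"
      then obtain U where U: "openin (Euclidean_space d) U" "x \<in> U"
        "\<forall>y\<in>U. \<bar>q y\<bar> \<le> e / 2 * n y" using B by (meson half_gt_zero)
      have "\<bar>q y / n y\<bar> < e" if y: "y \<in> U - {x}" for y
      proof -
        have n: "n y > 0" using y U n_pos by auto
        have "\<bar>q y\<bar> \<le> e / 2 * n y" using U y by blast
        also have "\<dots> < e * n y" using n \<open>e > 0\<close> by simp
        finally show ?thesis using n by (simp add: abs_divide divide_less_eq)
      qed
      then show "\<exists>U. openin (Euclidean_space d) U \<and> x \<in> U \<and> (\<forall>y\<in>U - {x}. \<bar>q y / n y\<bar> < e)"
        using U by blast
    qed
  qed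
  finally show ?thesis unfolding has_gradient_def q_def n_def by simp
qed

text \<open>Along \<open>g - h\<close> the two linear approximations drift apart at the rate
  \<open>N\<^sup>2\<close>, whereas the error bounds allow only \<open>2 * e * N\<close>. Uniqueness
  is what gives the definite description in \<open>gradient\<close> its meaning.\<close>

lemma has_gradient_unique:
  assumes x: "x \<in> Rd d" and g: "has_gradient d f g x" and h: "has_gradient d f h x"
  shows "g = h"
proof (rule ccontr)
  assume neq: "g \<noteq> h"
  define v where "v = vdiff g h"
  have gR: "g \<in> Rd d" and hR: "h \<in> Rd d" using g h by (auto simp: has_gradient_def)
  define N where "N = vnorm d v"
  have N: "N > 0" using vnorm_vdiff_pos[OF gR hR neq] by (simp add: N_def v_def)
  \<comment> \<open>With this choice the two errors add up to at most half of the gap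
    \<open>t * N\<^sup>2\<close>; any positive constant below \<open>N / 2\<close> would give a
    contradiction.\<close>
  define e where "e = N / 4"
  have "e > 0" using N by (simp add: e_def)
  then obtain U V where U: "openin (Euclidean_space d) U" "x \<in> U"
      "\<forall>y\<in>U. \<bar>f y - f x - dot d g (vdiff y x)\<bar> \<le> e * vnorm d (vdiff y x)"
    and V: "openin (Euclidean_space d) V" "x \<in> V"
      "\<forall>y\<in>V. \<bar>f y - f x - dot d h (vdiff y x)\<bar> \<le> e * vnorm d (vdiff y x)"
    using g h unfolding has_gradient_iff[OF x] by meson
  \<comment> \<open>The line through \<open>x\<close> in direction \<open>v\<close>. Cutting it off
    at \<open>d\<close> keeps every \<open>l t\<close> inside \<open>Rd d\<close>, and continuity
    puts \<open>l t\<close> into both neighbourhoods for small \<open>t > 0\<close>.\<close>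
  define l where "l = (\<lambda>t::real. \<lambda>i. if i < d then x i + t * v i else 0)"
  have "continuous_map euclideanreal (Euclidean_space d) l"
    unfolding l_def continuous_map_componentwise_Euclidean_space
    by (auto intro!: continuous_intros)
  then have "openin euclideanreal {t \<in> topspace euclideanreal. l t \<in> U \<inter> V}"
    by (rule openin_continuous_map_preimage) (use U V in auto)
  then have "open {t. l t \<in> U \<inter> V}" by simp
  moreover have "l 0 = x" using x by (auto simp: l_def Rd_iff)
  then have "0 \<in> {t. l t \<in> U \<inter> V}" using U V by simp
  ultimately obtain r where r: "r > 0" "ball 0 r \<subseteq> {t. l t \<in> U \<inter> V}"
    using open_contains_ball by blast
  define t where "t = r / 2"
  have t: "t > 0" "l t \<in> U" "l t \<in> V" using r by (auto simp: t_def subset_iff)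
  have v_out: "v i = 0" if "i \<ge> d" for i using gR hR that by (simp add: v_def Rd_iff)
  have diff: "vdiff (l t) x = (\<lambda>i. t * v i)"
    using x v_out by (auto simp: l_def Rd_iff fun_eq_iff not_less)
  have dt: "dot d w (vdiff (l t) x) = t * dot d w v" for w
    unfolding diff dot_def sum_distrib_left by (intro sum.cong) auto
  have nt: "vnorm d (vdiff (l t) x) = t * N"
    unfolding diff N_def using t by (simp add: L2_set_right_distrib)
  have "\<bar>t * dot d g v - t * dot d h v\<bar> \<le> 2 * (e * (t * N))"
    using U(3)[rule_format, OF t(2)] V(3)[rule_format, OF t(3)] unfolding dt nt by linarith
  moreover have "t * dot d g v - t * dot d h v = t * N\<^sup>2"
    unfolding N_def vnorm_power2 right_diff_distrib[symmetric] dot_def sum_subtractf[symmetric]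
    by (simp add: v_def left_diff_distrib)
  ultimately have "t * N\<^sup>2 \<le> t * N\<^sup>2 / 2"
    by (simp add: e_def power2_eq_square mult_ac)
  moreover have "t * N\<^sup>2 > 0" using t N by simp
  ultimately show False by linarith
qed

lemma gradient_eqI: "x \<in> Rd d \<Longrightarrow> has_gradient d f g x \<Longrightarrow> gradient d f x = g"
  unfolding gradient_def using has_gradient_unique by blast

section \<open>Block decomposition\<close>

text \<open>\<open>block\<close> and \<open>stack\<close> identify R^(K d) with K copies of R^d. The
  padding with zeros makes each block a genuine point of \<open>Rd d\<close>.\<close>

definition block :: "nat \<Rightarrow> nat \<Rightarrow> (nat \<Rightarrow> real) \<Rightarrow> nat \<Rightarrow> real" where
  "block d k x = (\<lambda>i. if i < d then x (k * d + i) else 0)"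

definition stack :: "nat \<Rightarrow> nat \<Rightarrow> (nat \<Rightarrow> nat \<Rightarrow> real) \<Rightarrow> nat \<Rightarrow> real" where
  "stack d K u = (\<lambda>j. if j < K * d then u (j div d) (j mod d) else 0)"

lemma block_in_Rd [simp]: "block d k x \<in> Rd d"
  by (simp add: Rd_iff block_def)

lemma stack_in_Rd [simp]: "stack d K u \<in> Rd (K * d)"
  by (simp add: Rd_iff stack_def)

lemma block_stack:
  assumes "k < K" "u k \<in> Rd d"
  shows "block d k (stack d K u) = u k"
proof
  fix i
  show "block d k (stack d K u) i = u k i"
  proof (cases "i < d")
    case True
    have "k * d + i < Suc k * d" using True by simp
    also have "\<dots> \<le> K * d" using assms(1) by (intro mult_le_mono1) simp
    finally show ?thesis using True by (simp add: block_def stack_def)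
  qed (use assms in \<open>simp add: block_def Rd_iff\<close>)
qed

lemma block_vdiff: "block d k (vdiff x y) = vdiff (block d k x) (block d k y)"
  by (auto simp: block_def)

text \<open>The indices below \<open>K * d\<close> split into \<open>K\<close> consecutive intervals
  of length \<open>d\<close>. With \<open>vnorm_power2\<close>, squared norms split in the same
  way.\<close>

lemma dot_blocks: "dot (K * d) x y = (\<Sum>k<K. dot d (block d k x) (block d k y))"
proof -
  have "dot (K * d) x y = (\<Sum>k<K. \<Sum>j\<in>{k * d..<k * d + d}. x j * y j)"
    unfolding dot_def sum.nat_group ..
  also have "\<dots> = (\<Sum>k<K. dot d (block d k x) (block d k y))"
  proof (rule sum.cong)
    fix k
    show "(\<Sum>j\<in>{k * d..<k * d + d}. x j * y j) = dot d (block d k x) (block d k y)"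
      using sum.shift_bounds_nat_ivl[of "\<lambda>j. x j * y j" 0 "k * d" d]
      by (simp add: dot_def block_def lessThan_atLeast0 add.commute)
  qed simp
  finally show ?thesis .
qed

lemma vnorm_block_le:
  assumes "k < K"
  shows "vnorm d (block d k x) \<le> vnorm (K * d) x"
proof (rule power2_le_imp_le)
  have "(vnorm d (block d k x))\<^sup>2 \<le> (\<Sum>k<K. (vnorm d (block d k x))\<^sup>2)"
    using assms by (intro member_le_sum) auto
  then show "(vnorm d (block d k x))\<^sup>2 \<le> (vnorm (K * d) x)\<^sup>2"
    by (simp add: vnorm_power2 dot_blocks)
qed simp

lemma continuous_map_block:
  assumes "k < K"
  shows "continuous_map (Euclidean_space (K * d)) (Euclidean_space d) (block d k)"
  unfolding block_def continuous_map_componentwise_Euclidean_space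
  unfolding Euclidean_space_def
  by (auto intro!: continuous_map_from_subtopology continuous_map_product_projection)

section \<open>Separable sums\<close>

text \<open>Each block contributes an error of at most \<open>e'\<close> times the norm of its own
  displacement, hence at most \<open>e'\<close> times that of the whole displacement; the
  \<open>K\<close> contributions together stay below the allowance \<open>e\<close>.\<close>

lemma has_gradient_separable_sum:
  assumes y: "y \<in> Rd (K * d)"
    and g: "\<And>k. k < K \<Longrightarrow> has_gradient d f (g k) (block d k y)"
  shows "has_gradient (K * d) (\<lambda>y. \<Sum>k<K. f (block d k y)) (stack d K g) y"
  unfolding has_gradient_iff[OF y]
proof (intro conjI allI impI stack_in_Rd)
  let ?E = "Euclidean_space (K * d)"
  fix e :: real assume e: "e > 0"
  \<comment> \<open>Dividing by \<open>Suc K\<close> instead of \<open>K\<close> covers the case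
    \<open>K = 0\<close>.\<close>
  define e' where "e' = e / real (Suc K)"
  have e': "e' > 0" using e unfolding e'_def by simp
  have "real (Suc K) * e' = e" unfolding e'_def by simp
  then have Ke': "real K * e' \<le> e" using e' by (simp add: distrib_right)
  have gR: "g k \<in> Rd d" if "k < K" for k using g[OF that] by (simp add: has_gradient_def)
  have "\<forall>k\<in>{..<K}. \<exists>U. openin (Euclidean_space d) U \<and> block d k y \<in> U \<and>
      (\<forall>z\<in>U. \<bar>f z - f (block d k y) - dot d (g k) (vdiff z (block d k y))\<bar>
        \<le> e' * vnorm d (vdiff z (block d k y)))"
    using g e' by (auto simp: has_gradient_iff)
  then obtain U where U: "\<forall>k\<in>{..<K}. openin (Euclidean_space d) (U k) \<and> block d k y \<in> U k \<and>
      (\<forall>z\<in>U k. \<bar>f z - f (block d k y) - dot d (g k) (vdiff z (block d k y))\<bar>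
        \<le> e' * vnorm d (vdiff z (block d k y)))"
    unfolding bchoice_iff by (elim exE)
  \<comment> \<open>The factor \<open>topspace ?E\<close> matters for \<open>K = 0\<close>, where
    the intersection over no blocks is the whole type and not a subset of
    \<open>Rd (K * d)\<close>.\<close>
  define W where "W = topspace ?E \<inter> (\<Inter>k<K. {z \<in> topspace ?E. block d k z \<in> U k})"
  have W: "openin ?E W"
  proof (cases "K = 0")
    case False
    then have "openin ?E (\<Inter>k<K. {z \<in> topspace ?E. block d k z \<in> U k})"
      using U by (intro openin_INT2 openin_continuous_map_preimage[OF continuous_map_block]) auto
    then show ?thesis unfolding W_def by (rule openin_Int[OF openin_topspace])
  qed (simp add: W_def)
  have "y \<in> W" using y U by (auto simp: W_def)
  moreover have "\<bar>(\<Sum>k<K. f (block d k z)) - (\<Sum>k<K. f (block d k y)) -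
      dot (K * d) (stack d K g) (vdiff z y)\<bar> \<le> e * vnorm (K * d) (vdiff z y)"
    if z: "z \<in> W" for z
  proof -
    let ?n = "vnorm (K * d) (vdiff z y)"
    have "\<bar>(\<Sum>k<K. f (block d k z)) - (\<Sum>k<K. f (block d k y)) -
        dot (K * d) (stack d K g) (vdiff z y)\<bar> =
        \<bar>\<Sum>k<K. f (block d k z) - f (block d k y) -
          dot d (g k) (vdiff (block d k z) (block d k y))\<bar>"
      by (simp add: dot_blocks block_stack gR block_vdiff sum_subtractf)
    also have "\<dots> \<le> (\<Sum>k<K. e' * ?n)"
    proof (intro order_trans[OF sum_abs] sum_mono)
      fix k assume k: "k \<in> {..<K}"
      have "\<bar>f (block d k z) - f (block d k y) - dot d (g k) (vdiff (block d k z) (block d k y))\<bar>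
          \<le> e' * vnorm d (block d k (vdiff z y))"
        using U k z by (simp add: W_def block_vdiff)
      also have "\<dots> \<le> e' * ?n"
        using vnorm_block_le k e' by (intro mult_left_mono) auto
      finally show "\<bar>f (block d k z) - f (block d k y) -
          dot d (g k) (vdiff (block d k z) (block d k y))\<bar> \<le> e' * ?n" .
    qed
    also have "\<dots> = (real K * e') * ?n" by simp
    also have "\<dots> \<le> e * ?n"
      by (intro mult_right_mono Ke') simp
    finally show ?thesis .
  qed
  ultimately show "\<exists>W. openin ?E W \<and> y \<in> W \<and> (\<forall>z\<in>W.
      \<bar>(\<Sum>k<K. f (block d k z)) - (\<Sum>k<K. f (block d k y)) -
        dot (K * d) (stack d K g) (vdiff z y)\<bar> \<le> e * vnorm (K * d) (vdiff z y))"
    using W by blast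
qed

lemma
  assumes f: "continuously_differentiable d f"
  shows has_gradient_gradient: "x \<in> Rd d \<Longrightarrow> has_gradient d f (gradient d f x) x"
    and gradient_in_Rd: "x \<in> Rd d \<Longrightarrow> gradient d f x \<in> Rd d"
proof -
  show *: "has_gradient d f (gradient d f x) x" if "x \<in> Rd d" for x
    using f that gradient_eqI unfolding continuously_differentiable_def by metis
  show "gradient d f x \<in> Rd d" if "x \<in> Rd d" for x
    using *[OF that] by (simp add: has_gradient_def)
qed

lemma
  assumes f: "continuously_differentiable d f" and y: "y \<in> Rd (K * d)"
  shows has_gradient_separable_sum':
      "has_gradient (K * d) (\<lambda>y. \<Sum>k<K. f (block d k y))
        (stack d K (\<lambda>k. gradient d f (block d k y))) y"
    and gradient_separable_sum:
      "gradient (K * d) (\<lambda>y. \<Sum>k<K. f (block d k y)) y =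
        stack d K (\<lambda>k. gradient d f (block d k y))"
proof -
  show *: "has_gradient (K * d) (\<lambda>y. \<Sum>k<K. f (block d k y))
      (stack d K (\<lambda>k. gradient d f (block d k y))) y"
    using f y by (intro has_gradient_separable_sum has_gradient_gradient) auto
  show "gradient (K * d) (\<lambda>y. \<Sum>k<K. f (block d k y)) y =
      stack d K (\<lambda>k. gradient d f (block d k y))"
    using gradient_eqI[OF y *] .
qed

text \<open>Coordinate \<open>j\<close> of the gradient is a composition of continuous maps:
  projection to block \<open>j div d\<close>, the gradient of \<open>f\<close>, and evaluation at
  \<open>j mod d\<close>.\<close>

lemma continuously_differentiable_separable_sum:
  assumes f: "continuously_differentiable d f"
  shows "continuously_differentiable (K * d) (\<lambda>y. \<Sum>k<K. f (block d k y))"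
    (is "continuously_differentiable _ ?F")
  unfolding continuously_differentiable_def
proof
  show "\<forall>x\<in>Rd (K * d). \<exists>g. has_gradient (K * d) ?F g x"
    using has_gradient_separable_sum'[OF f] by blast
  have "continuous_map (Euclidean_space (K * d)) (Euclidean_space (K * d))
      (\<lambda>y. stack d K (\<lambda>k. gradient d f (block d k y)))"
    unfolding stack_def continuous_map_componentwise_Euclidean_space
  proof (intro allI impI)
    fix j assume "j < K * d"
    \<comment> \<open>The assumption \<open>j < K * d\<close> forces \<open>d > 0\<close>, so the
      remainder is below \<open>d\<close>.\<close>
    then have "j div d < K" "j mod d < d"
      by (auto simp: less_mult_imp_div_less intro!: mod_less_divisor gr0I)
    have "continuous_map (Euclidean_space d) euclideanreal (\<lambda>z. z (j mod d))"
      unfolding Euclidean_space_def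
      by (auto intro!: continuous_map_from_subtopology continuous_map_product_projection)
    moreover have "continuous_map (Euclidean_space d) (Euclidean_space d) (gradient d f)"
      using f by (simp add: continuously_differentiable_def)
    ultimately have "continuous_map (Euclidean_space (K * d)) euclideanreal
        ((\<lambda>z. z (j mod d)) \<circ> (gradient d f \<circ> block d (j div d)))"
      using continuous_map_block[OF \<open>j div d < K\<close>] by (meson continuous_map_compose)
    then show "continuous_map (Euclidean_space (K * d)) euclideanreal
        (\<lambda>y. gradient d f (block d (j div d) y) (j mod d))"
      by (simp add: o_def)
  qed
  then show "continuous_map (Euclidean_space (K * d)) (Euclidean_space (K * d))
      (gradient (K * d) ?F)"
    by (rule continuous_map_eq) (simp add: gradient_separable_sum[OF f])
qed

text \<open>Function value, linear term and squared norm are all additive over blocks, so each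
  defining inequality is a sum of \<open>K\<close> instances for \<open>f\<close> with the same
  constant.\<close>

lemma smooth_strongly_convex_separable_sum:
  assumes f: "f \<in> smooth_strongly_convex \<mu> L d"
  shows "(\<lambda>y. \<Sum>k<K. f (block d k y)) \<in> smooth_strongly_convex \<mu> L (K * d)"
    (is "?F \<in> _")
proof -
  have cd: "continuously_differentiable d f" using f by (simp add: smooth_strongly_convex_def)
  \<comment> \<open>The coefficient \<open>a\<close> is kept general to serve both \<open>L\<close>
    and \<open>\<mu>\<close>.\<close>
  have expand: "?F y + dot (K * d) (gradient (K * d) ?F y) (vdiff x y) +
      a / 2 * (vnorm (K * d) (vdiff x y))\<^sup>2 =
      (\<Sum>k<K. f (block d k y)
        + dot d (gradient d f (block d k y)) (vdiff (block d k x) (block d k y))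
        + a / 2 * (vnorm d (vdiff (block d k x) (block d k y)))\<^sup>2)"
    if "y \<in> Rd (K * d)" for x y a
    using that cd
    by (simp add: gradient_separable_sum vnorm_power2 dot_blocks block_vdiff block_stack
        gradient_in_Rd sum.distrib sum_distrib_left)
  show ?thesis
    unfolding smooth_strongly_convex_def mem_Collect_eq
  proof (intro conjI ballI continuously_differentiable_separable_sum cd)
    fix x y assume "x \<in> Rd (K * d)" and y: "y \<in> Rd (K * d)"
    show "?F x \<le> ?F y + dot (K * d) (gradient (K * d) ?F y) (vdiff x y) +
        L / 2 * (vnorm (K * d) (vdiff x y))\<^sup>2"
      unfolding expand[OF y] using f by (intro sum_mono) (simp add: smooth_strongly_convex_def)
    show "?F x \<ge> ?F y + dot (K * d) (gradient (K * d) ?F y) (vdiff x y) +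
        \<mu> / 2 * (vnorm (K * d) (vdiff x y))\<^sup>2"
      unfolding expand[OF y] using f by (intro sum_mono) (simp add: smooth_strongly_convex_def)
  qed
qed

section \<open>Symmetrized cycles\<close>

text \<open>Indices are reduced modulo \<open>K\<close> because \<open>x\<close> carries information
  only below \<open>K\<close>.\<close>

definition shifts :: "nat \<Rightarrow> nat \<Rightarrow> (nat \<Rightarrow> nat \<Rightarrow> real) \<Rightarrow> nat \<Rightarrow> nat \<Rightarrow> real" where
  "shifts d K x t = stack d K (\<lambda>k. x ((t + k) mod K))"

lemma shifts_mod: "shifts d K x (t mod K) = shifts d K x t"
  by (simp add: shifts_def mod_add_left_eq)

lemma block_shifts:
  assumes "\<And>t. t < K \<Longrightarrow> x t \<in> Rd d" "k < K"
  shows "block d k (shifts d K x t) = x ((t + k) mod K)"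
  unfolding shifts_def using assms by (intro block_stack) auto

lemma HB_cycles_on_shifts:
  assumes f: "f \<in> smooth_strongly_convex \<mu> L d" and cyc: "HB_cycles_on \<gamma> \<beta> d f K x"
  shows "HB_cycles_on \<gamma> \<beta> (K * d) (\<lambda>y. \<Sum>k<K. f (block d k y)) K (shifts d K x)"
proof -
  let ?F = "\<lambda>y. \<Sum>k<K. f (block d k y)"
  have cd: "continuously_differentiable d f" using f by (simp add: smooth_strongly_convex_def)
  have xR: "x t \<in> Rd d" if "t < K" for t using cyc that by (simp add: HB_cycles_on_def)
  obtain s t where st: "s < K" "t < K" "x s \<noteq> x t" using cyc by (auto simp: HB_cycles_on_def)
  have orbit: "heavy_ball \<gamma> \<beta> d f (x 0) (x 1) t = x (t mod K)" for t
    using cyc by (simp add: HB_cycles_on_def)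
  \<comment> \<open>The recurrence read off the closed orbit: it holds for the points of the cycle
    with cyclic indices, at every \<open>t\<close>.\<close>
  have step: "x (Suc (Suc t) mod K) i = x (Suc t mod K) i - \<gamma> * gradient d f (x (Suc t mod K)) i
      + \<beta> * (x (Suc t mod K) i - x (t mod K) i)" for t i
    using fun_cong[OF heavy_ball.simps(3)[of \<gamma> \<beta> d f "x 0" "x 1" t], of i] unfolding orbit .
  have grad: "gradient (K * d) ?F (shifts d K x t) =
      stack d K (\<lambda>k. gradient d f (x ((t + k) mod K)))" for t
  proof -
    have "shifts d K x t \<in> Rd (K * d)" by (simp add: shifts_def)
    from gradient_separable_sum[OF cd this] show ?thesis
      by (simp add: stack_def fun_eq_iff block_shifts xR less_mult_imp_div_less)
  qed
  have "heavy_ball \<gamma> \<beta> (K * d) ?F (shifts d K x 0) (shifts d K x 1) t = shifts d K x t" for t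
  \<comment> \<open>The recurrence refers to two previous iterates, hence the two base
    cases.\<close>
  proof (induction t rule: induct_nat_012)
    case (ge2 t)
    show ?case
      unfolding heavy_ball.simps ge2 grad
      \<comment> \<open>The offset stays open because block \<open>k\<close> runs \<open>k\<close>
        steps ahead and needs the recurrence at \<open>t + k\<close>.\<close>
      using step[of "t + _"] by (simp add: shifts_def stack_def fun_eq_iff)
  qed simp_all
  \<comment> \<open>Block 0 of \<open>shifts d K x t\<close> is \<open>x t\<close> itself, so
    distinct points remain distinct.\<close>
  moreover have "shifts d K x s \<noteq> shifts d K x t"
    using block_shifts[of K x d 0] xR st by (metis add_0_right gr_implies_not0 gr0I mod_less)
  ultimately show ?thesis
    using st by (auto simp: HB_cycles_on_def shifts_mod) (auto simp: shifts_def)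
qed

text \<open>Sliding the window by one loses \<open>h t\<close> and gains \<open>h (t + K)\<close>,
  which are equal.\<close>

lemma sum_periodic_shift:
  fixes h :: "nat \<Rightarrow> real"
  assumes "\<And>k. h (k + K) = h k"
  shows "(\<Sum>k<K. h (t + k)) = (\<Sum>k<K. h k)"
proof (induction t)
  case (Suc t)
  have "h t + (\<Sum>k<K. h (Suc t + k)) = (\<Sum>k<K. h (t + k)) + h (t + K)"
    using sum.lessThan_Suc_shift[of "\<lambda>k. h (t + k)" K] by simp
  then show ?case using Suc assms by simp
qed simp

text \<open>Blockwise, the left side is the sum of a \<open>K\<close>-periodic sequence over the
  window of length \<open>K\<close> starting at \<open>t\<close>, so the window may be moved back to
  0.\<close>

lemma dot_shifts:
  assumes "\<And>t. t < K \<Longrightarrow> x t \<in> Rd d"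
  shows "dot (K * d) (shifts d K x t) (shifts d K x (t + s)) =
    dot (K * d) (shifts d K x 0) (shifts d K x s)"
proof -
  define h where "h k = dot d (x (k mod K)) (x ((k + s) mod K))" for k
  have "(k + K + s) mod K = (k + s) mod K" for k
    using mod_add_self2[of "k + s" K] by (simp only: add_ac)
  then have "h (k + K) = h k" for k by (simp add: h_def)
  then have "(\<Sum>k<K. h (t + k)) = (\<Sum>k<K. h (0 + k))"
    by (simp add: sum_periodic_shift[of h])
  moreover have "dot (K * d) (shifts d K x t) (shifts d K x (t + s)) = (\<Sum>k<K. h (t + k))" for t
    unfolding dot_blocks
    by (intro sum.cong) (simp_all add: block_shifts assms h_def add.commute add.left_commute)
  ultimately show ?thesis by (metis add_0)
qed

theorem corollary6p9:
  fixes \<mu> L \<gamma> \<beta> :: real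
  assumes "0 < \<mu>" and "\<mu> < L"
    and "(\<gamma>, \<beta>) \<in> Omega_cv L"
    and "HB_has_cycle \<gamma> \<beta> \<mu> L"
  shows "\<exists>(d::nat) (K::nat) (x :: nat \<Rightarrow> nat \<Rightarrow> real) (f :: (nat \<Rightarrow> real) \<Rightarrow> real) (c :: nat \<Rightarrow> real).
           d \<ge> 1 \<and> K \<ge> 2 \<and> f \<in> smooth_strongly_convex \<mu> L d \<and>
           HB_cycles_on \<gamma> \<beta> d f K x \<and>
           symmetric_matrix K (gram d x) \<and> circulant K (gram d x) \<and>
           (\<forall>t<K. (vnorm d (x t))\<^sup>2 = c 0) \<and>
           (\<forall>t<K. dot d (x t) (x ((t + 1) mod K)) = c 1) \<and>
           (\<forall>s<K. \<forall>t<K. dot d (x t) (x ((t + s) mod K)) = c s)"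
proof -
  obtain d K x f where d: "d \<ge> 1" and f: "f \<in> smooth_strongly_convex \<mu> L d"
    and cyc: "HB_cycles_on \<gamma> \<beta> d f K x"
    using assms(4) by (auto simp: HB_has_cycle_def)
  have xR: "x t \<in> Rd d" if "t < K" for t using cyc that by (simp add: HB_cycles_on_def)
  obtain s t where "s < K" "t < K" "x s \<noteq> x t" using cyc by (auto simp: HB_cycles_on_def)
  then have K: "K \<ge> 2" by (cases "s = t") auto
  define X where "X = shifts d K x"
  define c where "c = (\<lambda>s. dot (K * d) (X 0) (X s))"
  have Xmod: "X (t mod K) = X t" for t by (simp add: X_def shifts_mod)
  have c: "dot (K * d) (X t) (X (t + s)) = c s" for s t
    unfolding X_def c_def using xR by (rule dot_shifts)
  have "symmetric_matrix K (gram (K * d) X)"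
    by (simp add: symmetric_matrix_def gram_def dot_commute)
  moreover have "circulant K (gram (K * d) X)"
  proof -
    have "gram (K * d) X i j = c (nat ((int j - int i) mod int K))" if "j < K" for i j
    proof -
      \<comment> \<open>The representative of \<open>j - i\<close> in \<open>{0..<K}\<close>,
        computed in the integers since \<open>j - i\<close> may be negative. Then
        \<open>i + s\<close> is congruent to \<open>j\<close>, and \<open>Xmod\<close> identifies
        the two points.\<close>
      define s where "s = nat ((int j - int i) mod int K)"
      have "int s = (int j - int i) mod int K" using K by (simp add: s_def)
      then have "int ((i + s) mod K) = int j"
        using that by (simp add: of_nat_mod mod_add_right_eq)
      then have "X (i + s) = X j" by (metis Xmod of_nat_eq_iff)
      then show ?thesis using c[of i s] by (simp add: gram_def s_def)
    qed
    then show ?thesis by (simp add: circulant_def)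
  qed
  \<comment> \<open>The squared norm is the entry at shift \<open>s = 0\<close>.\<close>
  moreover have "(vnorm (K * d) (X t))\<^sup>2 = c 0" for t using c[of t 0] by (simp add: vnorm_power2)
  moreover have "dot (K * d) (X t) (X ((t + s) mod K)) = c s" for s t by (simp only: Xmod c)
  moreover have "K * d \<ge> 1" using K d by simp
  ultimately show ?thesis
    using K smooth_strongly_convex_separable_sum[OF f, of K]
      HB_cycles_on_shifts[OF f cyc, folded X_def]
    by - (rule exI[of _ "K * d"], rule exI[of _ K], rule exI[of _ X],
        rule exI[of _ "\<lambda>y. \<Sum>k<K. f (block d k y)"], rule exI[of _ c], blast)
qed

end
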